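(* Let $C\in\mathcal{X}$ and $\psi\in\mathbf{N}$. A finite Gibbs process with PI $\kappa^{(C,\psi)}$ exists if, and only if, $Z_C(\psi)<\infty$. If $\xi$ is such a finite Gibbs process in $\mathbb{X}$ with PI $\kappa^{(C,\psi)}$ and reference measure $\lambda$, then the distribution $\mathbb{P}^\xi$ of $\xi$ is given by $$\mathbb{P}^\xi(\cdot)=\frac1{Z_C(\psi)}\Big(\mathbf{1}\{\mathbf{0}\in\cdot\,\}+\sum_{m=1}^\infty\frac1{m!}\int_{C^m}\mathbf{1}\Big\{\sum_{j=1}^m\delta_{x_j}\in\cdot\,\Big\}\,\kappa_m(x_1,\dots,x_m,\psi)\,\mathrm{d}\lambda^m(x_1,\dots,x_m)\Big).$$
   Context: Setting. $(\mathbb{X},\mathcal{X})$ is a measurable space which is localized: there are fixed sets $B_1\subset B_2\subset\dots$ in $\mathcal{X}$ with $\bigcup_j B_j=\mathbb{X}$. $\mathcal{X}_b$ is the collection of all sets in $\mathcal{X}$ contained in some $B_j$. $\mathbf{N}$ is the set of all measures $\mu$ on $\mathbb{X}$ with $\mu(B)\in\{0,1,2,\dots\}$ for each $B\in\mathcal{X}_b$, with the $\sigma$-field $\mathcal{N}$ generated by the maps $\mu\mapsto\mu(B)$, $B\in\mathcal{X}$. A point process in $\mathbb{X}$ is a random element of $\mathbf{N}$ on some probability space. $\delta_x$ is the Dirac measure in $x$, $\mathbf{0}$ the zero measure. $\lambda$ is a fixed locally finite measure on $\mathbb{X}$ ($\lambda(B)<\infty$ for $B\in\mathcal{X}_b$),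 the reference measure. $\kappa:\mathbb{X}\times\mathbf{N}\to[0,\infty)$ is a fixed measurable map satisfying the cocycle relation $\kappa(x,\mu)\kappa(y,\mu+\delta_x)=\kappa(y,\mu)\kappa(x,\mu+\delta_y)$ for all $x,y\in\mathbb{X}$, $\mu\in\mathbf{N}$. For $m\in\mathbb{N}$, $$\kappa_m(x_1,\dots,x_m,\mu)=\kappa(x_m,\mu)\,\kappa(x_{m-1},\mu+\delta_{x_m})\cdots\kappa(x_1,\mu+\delta_{x_2}+\dots+\delta_{x_m}),$$ and for $B\in\mathcal{X}$ the partition function is $Z_B(\psi)=1+\sum_{m=1}^\infty\frac1{m!}\int_{B^m}\kappa_m(x_1,\dots,x_m,\psi)\,\mathrm{d}\lambda^m(x_1,\dots,x_m)\in[1,\infty]$. Moreover $\kappa^{(C,\psi)}(x,\mu)=\kappa(x,\psi+\mu)\,\mathbf{1}_C(x)$. Gibbs process. For measurable $\tilde\kappa:\mathbb{X}\times\mathbf{N}\to[0,\infty)$, a point process $\eta$ is a Gibbs process with Papangelou intensity (PI) $\tilde\kappa$ and reference measure $\lambda$ if $\mathbb{E}[\int_{\mathbb{X}}f(x,\eta)\,\mathrm{d}\eta(x)]=\mathbb{E}[\int_{\mathbb{X}}f(x,\eta+\delta_x)\,\tilde\kappa(x,\eta)\,\mathrm{d}\lambda(x)]$ for all measurable $f:\mathbb{X}\times\mathbf{N}\to[0,\infty]$. It is finite if it is almost surely a finite measure. *)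

theory Defs
  imports "HOL-Probability.Probability"
begin

text \<open>
  The space and the sigma-field of the ground space are those of a measure \<open>M\<close>; in the theorem
  \<open>M\<close> is the reference measure. The values of \<open>M\<close> only matter where \<open>M\<close> is integrated against.
  The sets \<open>B 0, B 1, \<dots>\<close> are the localizing sets, numbered from 0.
\<close>

definition localizing :: "'a measure \<Rightarrow> (nat \<Rightarrow> 'a set) \<Rightarrow> bool" where
  "localizing M B \<longleftrightarrow> range B \<subseteq> sets M \<and> incseq B \<and> (\<Union>j. B j) = space M"

definition bounded_sets :: "'a measure \<Rightarrow> (nat \<Rightarrow> 'a set) \<Rightarrow> 'a set set" where
  "bounded_sets M B = {A \<in> sets M. \<exists>j. A \<subseteq> B j}"

definition locally_finite :: "'a measure \<Rightarrow> (nat \<Rightarrow> 'a set) \<Rightarrow> bool" where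
  "locally_finite M B \<longleftrightarrow> (\<forall>A\<in>bounded_sets M B. emeasure M A < \<infinity>)"

definition counting_measures :: "'a measure \<Rightarrow> (nat \<Rightarrow> 'a set) \<Rightarrow> 'a measure set" where
  "counting_measures M B =
    {\<mu>. sets \<mu> = sets M \<and> (\<forall>A\<in>bounded_sets M B. emeasure \<mu> A \<in> range (of_nat :: nat \<Rightarrow> ennreal))}"

definition counting_algebra :: "'a measure \<Rightarrow> (nat \<Rightarrow> 'a set) \<Rightarrow> 'a measure measure" where
  "counting_algebra M B = sigma (counting_measures M B)
    {(\<lambda>\<mu>. emeasure \<mu> A) -` U \<inter> counting_measures M B | A U. A \<in> sets M \<and> U \<in> sets borel}"

definition plus_measure :: "'a measure \<Rightarrow> 'a measure \<Rightarrow> 'a measure" where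
  "plus_measure \<mu> \<nu> = measure_of (space \<mu>) (sets \<mu>) (\<lambda>A. emeasure \<mu> A + emeasure \<nu> A)"

text \<open>
  The Dirac measure in \<open>x\<close> is \<open>return M x\<close>, and the zero measure is \<open>null_measure M\<close>.
\<close>

definition dirac_sum :: "'a measure \<Rightarrow> 'i set \<Rightarrow> ('i \<Rightarrow> 'a) \<Rightarrow> 'a measure" where
  "dirac_sum M I x = measure_of (space M) (sets M) (\<lambda>A. \<Sum>i\<in>I. emeasure (return M (x i)) A)"

lemma emeasure_plus_measure:
  assumes "sets \<nu> = sets \<mu>" "A \<in> sets \<mu>"
  shows "emeasure (plus_measure \<mu> \<nu>) A = emeasure \<mu> A + emeasure \<nu> A"
proof (rule emeasure_measure_of[OF plus_measure_def])
  show "countably_additive (sets (plus_measure \<mu> \<nu>)) (\<lambda>A. emeasure \<mu> A + emeasure \<nu> A)"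
  proof (rule countably_additiveI)
    fix F :: "nat \<Rightarrow> 'a set"
    assume "range F \<subseteq> sets (plus_measure \<mu> \<nu>)" and F: "disjoint_family F"
    then have "range F \<subseteq> sets \<mu>" "range F \<subseteq> sets \<nu>"
      using assms(1) by (auto simp: plus_measure_def)
    then show "(\<Sum>i. emeasure \<mu> (F i) + emeasure \<nu> (F i))
        = emeasure \<mu> (\<Union>i. F i) + emeasure \<nu> (\<Union>i. F i)"
      using F by (simp add: suminf_add[symmetric] suminf_emeasure)
  qed
qed (use assms sets.space_closed in \<open>auto simp: positive_def plus_measure_def\<close>)

lemma emeasure_dirac_sum:
  assumes "A \<in> sets M"
  shows "emeasure (dirac_sum M I x) A = (\<Sum>i\<in>I. indicator A (x i))"
proof -
  have "emeasure (dirac_sum M I x) A = (\<Sum>i\<in>I. emeasure (return M (x i)) A)"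
  proof (rule emeasure_measure_of[OF dirac_sum_def])
    show "countably_additive (sets (dirac_sum M I x)) (\<lambda>A. \<Sum>i\<in>I. emeasure (return M (x i)) A)"
    proof (rule countably_additiveI)
      fix F :: "nat \<Rightarrow> 'a set"
      assume "range F \<subseteq> sets (dirac_sum M I x)" and F: "disjoint_family F"
      then have "range F \<subseteq> sets (return M y)" for y
        by (auto simp: dirac_sum_def)
      then show "(\<Sum>j. \<Sum>i\<in>I. emeasure (return M (x i)) (F j))
          = (\<Sum>i\<in>I. emeasure (return M (x i)) (\<Union>j. F j))"
        using F by (subst suminf_sum) (auto intro!: sum.cong simp: suminf_indicator sets.countable_UN)
    qed
  qed (use assms sets.space_closed in \<open>auto simp: positive_def dirac_sum_def\<close>)
  then show ?thesis
    using assms by simp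
qed

definition intensity :: "'a measure \<Rightarrow> (nat \<Rightarrow> 'a set) \<Rightarrow> ('a \<Rightarrow> 'a measure \<Rightarrow> ennreal) \<Rightarrow> bool" where
  "intensity M B \<kappa> \<longleftrightarrow>
    (\<lambda>(x, \<mu>). \<kappa> x \<mu>) \<in> borel_measurable (M \<Otimes>\<^sub>M counting_algebra M B) \<and>
    (\<forall>x\<in>space M. \<forall>\<mu>\<in>counting_measures M B. \<kappa> x \<mu> < \<infinity>)"

definition cocycle :: "'a measure \<Rightarrow> (nat \<Rightarrow> 'a set) \<Rightarrow> ('a \<Rightarrow> 'a measure \<Rightarrow> ennreal) \<Rightarrow> bool" where
  "cocycle M B \<kappa> \<longleftrightarrow> (\<forall>x\<in>space M. \<forall>y\<in>space M. \<forall>\<mu>\<in>counting_measures M B.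
    \<kappa> x \<mu> * \<kappa> y (plus_measure \<mu> (return M x)) = \<kappa> y \<mu> * \<kappa> x (plus_measure \<mu> (return M y)))"

text \<open>
  The point \<open>(x\<^sub>1, \<dots>, x\<^sub>m)\<close> is a function on \<open>{1..m}\<close>; the factor with index \<open>i\<close> is evaluated at
  \<open>\<mu> + \<delta>\<^bsub>x(i+1)\<^esub> + \<dots> + \<delta>\<^bsub>x(m)\<^esub>\<close>.
\<close>

definition kappa_m ::
  "'a measure \<Rightarrow> ('a \<Rightarrow> 'a measure \<Rightarrow> ennreal) \<Rightarrow> nat \<Rightarrow> (nat \<Rightarrow> 'a) \<Rightarrow> 'a measure \<Rightarrow> ennreal" where
  "kappa_m M \<kappa> m x \<mu> = (\<Prod>i=1..m. \<kappa> (x i) (plus_measure \<mu> (dirac_sum M {i<..m} x)))"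

text \<open>The term with index \<open>n\<close> of the series below is the one with \<open>m = n + 1\<close> points.\<close>

definition partition_function ::
  "'a measure \<Rightarrow> ('a \<Rightarrow> 'a measure \<Rightarrow> ennreal) \<Rightarrow> 'a set \<Rightarrow> 'a measure \<Rightarrow> ennreal" where
  "partition_function M \<kappa> C \<psi> = 1 + (\<Sum>n. ennreal (1 / fact (Suc n)) *
    (\<integral>\<^sup>+ x \<in> (\<Pi>\<^sub>E i\<in>{1..Suc n}. C). kappa_m M \<kappa> (Suc n) x \<psi> \<partial>(\<Pi>\<^sub>M i\<in>{1..Suc n}. M)))"

definition restricted_intensity ::
  "('a \<Rightarrow> 'a measure \<Rightarrow> ennreal) \<Rightarrow> 'a set \<Rightarrow> 'a measure \<Rightarrow> 'a \<Rightarrow> 'a measure \<Rightarrow> ennreal" where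
  "restricted_intensity \<kappa> C \<psi> x \<mu> = \<kappa> x (plus_measure \<psi> \<mu>) * indicator C x"

definition point_process ::
  "'a measure \<Rightarrow> (nat \<Rightarrow> 'a set) \<Rightarrow> 'w measure \<Rightarrow> ('w \<Rightarrow> 'a measure) \<Rightarrow> bool" where
  "point_process M B \<Omega> \<eta> \<longleftrightarrow> prob_space \<Omega> \<and> \<eta> \<in> measurable \<Omega> (counting_algebra M B)"

definition gibbs_process ::
  "'a measure \<Rightarrow> (nat \<Rightarrow> 'a set) \<Rightarrow> ('a \<Rightarrow> 'a measure \<Rightarrow> ennreal) \<Rightarrow>
    'w measure \<Rightarrow> ('w \<Rightarrow> 'a measure) \<Rightarrow> bool" where
  "gibbs_process M B \<kappa> \<Omega> \<eta> \<longleftrightarrow> intensity M B \<kappa> \<and> point_process M B \<Omega> \<eta> \<and>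
    (\<forall>f \<in> borel_measurable (M \<Otimes>\<^sub>M counting_algebra M B).
      (\<integral>\<^sup>+ \<omega>. (\<integral>\<^sup>+ x. f (x, \<eta> \<omega>) \<partial>(\<eta> \<omega>)) \<partial>\<Omega>) =
      (\<integral>\<^sup>+ \<omega>. (\<integral>\<^sup>+ x. f (x, plus_measure (\<eta> \<omega>) (return M x)) * \<kappa> x (\<eta> \<omega>) \<partial>M) \<partial>\<Omega>))"

definition finite_gibbs_process ::
  "'a measure \<Rightarrow> (nat \<Rightarrow> 'a set) \<Rightarrow> ('a \<Rightarrow> 'a measure \<Rightarrow> ennreal) \<Rightarrow>
    'w measure \<Rightarrow> ('w \<Rightarrow> 'a measure) \<Rightarrow> bool" where
  "finite_gibbs_process M B \<kappa> \<Omega> \<eta> \<longleftrightarrow>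
    gibbs_process M B \<kappa> \<Omega> \<eta> \<and> (AE \<omega> in \<Omega>. finite_measure (\<eta> \<omega>))"

end

theory Submission
  imports Defs
begin

text \<open>
  Write \<open>N\<close> for the space of counting measures and let an intensity \<open>\<kappa>\<close> act on functions of counting
  measures by \<open>(H g)(\<mu>) = \<integral> g(\<mu> + \<delta>\<^sub>x) \<kappa>(x, \<mu>) d\<lambda>(x)\<close>: one point is added to \<open>\<mu>\<close>. Iterating from the
  zero measure \<open>0\<close> adds \<open>n\<close> points one after the other, and by Tonelli
  \<open>(H\<^sup>n g)(0) = \<integral> g(\<delta>\<^bsub>x(1)\<^esub> + \<dots> + \<delta>\<^bsub>x(n)\<^esub>) \<kappa>\<^sub>n(x(1), \<dots>, x(n), 0) d\<lambda>\<^sup>n\<close> (\<open>growth_funpow_eq\<close>).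
  With \<open>W g = \<Sum>n. (H\<^sup>n g)(0) / n!\<close> and the intensity \<open>\<kappa>\<^bsup>(C,\<psi>)\<^esup>\<close> in place of \<open>\<kappa>\<close>, the partition
  function is \<open>W 1\<close> and the claimed law is \<open>A \<mapsto> W 1\<^sub>A / W 1\<close>.

  Uniqueness. Let \<open>\<xi>\<close> be a finite Gibbs process. Applying the Gibbs equation to
  \<open>f(x, \<mu>) = g(\<mu>) 1{\<mu> has mass n + 1}\<close> gives
  \<open>(n + 1) E[g(\<xi>); |\<xi>| = n + 1] = E[(H g)(\<xi>); |\<xi>| = n]\<close>. By induction
  \<open>n! E[g(\<xi>); |\<xi>| = n] = P(\<xi> = 0) (H\<^sup>n g)(0)\<close> (\<open>gibbs_level\<close>), and since \<open>|\<xi>|\<close> is almost surely a natural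
  number, summation over \<open>n\<close> gives \<open>E[g(\<xi>)] = P(\<xi> = 0) W g\<close>. The choice \<open>g = 1\<close> yields
  \<open>P(\<xi> = 0) W 1 = 1\<close>, hence \<open>W 1 < \<infinity>\<close> and the formula for the law.

  Existence. If \<open>W 1 < \<infinity>\<close>, then \<open>W / W 1\<close> is integration against a probability law on \<open>N\<close> that is
  carried by finite measures. The Gibbs equation for it says \<open>W (S f) = W (K f)\<close>, where
  \<open>(S f)(\<mu>) = \<integral> f(x, \<mu>) d\<mu>(x)\<close> and \<open>(K f)(\<mu>) = \<integral> f(x, \<mu> + \<delta>\<^sub>x) \<kappa>(x, \<mu>) d\<lambda>(x)\<close>. Let \<open>H\<close> also act on
  functions of \<open>(x, \<mu>)\<close>, with \<open>x\<close> held fixed. Splitting an integral against \<open>\<mu> + \<delta>\<^sub>x\<close> gives the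
  Leibniz rule \<open>H S = S H + K\<close> (\<open>growth_self_integral\<close>), and the cocycle relation makes
  the addition of two points independent of their order, \<open>K H = H K\<close> (\<open>insertion_growth_at\<close>).
  As \<open>S f\<close> vanishes at \<open>0\<close>, these give \<open>(H\<^bsup>n+1\<^esup> S f)(0) = (n + 1) (H\<^sup>n K f)(0)\<close>; dividing by
  \<open>(n + 1)!\<close> and summing gives the Gibbs equation.
\<close>

section \<open>Integrals against sums of measures\<close>

lemma emeasure_suminf_measure:
  fixes Q :: "nat \<Rightarrow> 'b measure"
  assumes sets: "\<And>n. sets (Q n) = sets M" and A: "A \<in> sets M"
  shows "emeasure (measure_of (space M) (sets M) (\<lambda>A. \<Sum>n. emeasure (Q n) A)) A
    = (\<Sum>n. emeasure (Q n) A)"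
proof (rule emeasure_measure_of_sigma)
  show "countably_additive (sets M) (\<lambda>A. \<Sum>n. emeasure (Q n) A)"
  proof (rule countably_additiveI)
    fix F :: "nat \<Rightarrow> 'b set"
    assume F: "range F \<subseteq> sets M" "disjoint_family F"
    have "(\<Sum>i. \<Sum>n. emeasure (Q n) (F i))
        = (\<integral>\<^sup>+n. (\<Sum>i. emeasure (Q n) (F i)) \<partial>count_space UNIV)"
      by (subst nn_integral_suminf) (simp_all add: nn_integral_count_space_nat)
    also have "\<dots> = (\<Sum>n. emeasure (Q n) (\<Union>i. F i))"
      using F by (simp add: nn_integral_count_space_nat suminf_emeasure sets)
    finally show "(\<Sum>i. \<Sum>n. emeasure (Q n) (F i)) = (\<Sum>n. emeasure (Q n) (\<Union>i. F i))" .
  qed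
qed (use A in \<open>auto simp: positive_def sets.sigma_algebra_axioms\<close>)

lemma suminf_ennreal_split_first:
  "(\<Sum>n. f n) = f 0 + (\<Sum>n. f (Suc n))" for f :: "nat \<Rightarrow> ennreal"
  using suminf_offset[of f 1] by simp

lemma nn_integral_suminf_measure:
  fixes Q :: "nat \<Rightarrow> 'b measure"
  assumes f: "f \<in> borel_measurable M"
    and sets: "\<And>n. sets (Q n) = sets M"
    and sum: "\<And>A. A \<in> sets M \<Longrightarrow> emeasure M A = (\<Sum>n. emeasure (Q n) A)"
  shows "integral\<^sup>N M f = (\<Sum>n. integral\<^sup>N (Q n) f)"
  using f
proof (induction rule: borel_measurable_induct)
  note [measurable_cong] = sets
  have space: "space (Q n) = space M" for n
    using sets[of n] by (rule sets_eq_imp_space_eq)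
  {
    case (cong f g)
    moreover have "integral\<^sup>N M f = integral\<^sup>N M g" "integral\<^sup>N (Q n) f = integral\<^sup>N (Q n) g" for n
      using cong(3) by (auto intro!: nn_integral_cong simp: space)
    ultimately show ?case
      by simp
  next
    case (set A)
    then show ?case
      by (simp add: sum sets)
  next
    case (mult u c)
    then show ?case
      by (simp add: nn_integral_cmult)
  next
    case (add u v)
    then show ?case
      by (simp add: nn_integral_add suminf_add)
  next
    case (seq U)
    have eq: "integral\<^sup>N M' (\<Squnion>(range U)) = (SUP i. integral\<^sup>N M' (U i))"
      if [measurable_cong]: "sets M' = sets M" for M'
    proof -
      have "integral\<^sup>N M' (\<Squnion>(range U)) = (\<integral>\<^sup>+x. (SUP i. U i x) \<partial>M')"
        by (intro nn_integral_cong) (simp add: image_comp)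
      also have "\<dots> = (SUP i. integral\<^sup>N M' (U i))"
        using seq by (intro nn_integral_monotone_convergence_SUP) auto
      finally show ?thesis .
    qed
    have inc: "incseq (\<lambda>i. integral\<^sup>N (Q n) (U i))" for n
      using seq by (auto intro!: nn_integral_mono simp: incseq_def le_fun_def)
    have "(\<Sum>n. integral\<^sup>N (Q n) (\<Squnion>(range U)))
        = (\<integral>\<^sup>+n. (SUP i. integral\<^sup>N (Q n) (U i)) \<partial>count_space UNIV)"
      by (simp add: nn_integral_count_space_nat eq sets)
    also have "\<dots> = (SUP i. \<integral>\<^sup>+n. integral\<^sup>N (Q n) (U i) \<partial>count_space UNIV)"
      using inc by (intro nn_integral_monotone_convergence_SUP) (auto simp: incseq_def le_fun_def)
    also have "\<dots> = integral\<^sup>N M (\<Squnion>(range U))"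
      using seq by (simp add: nn_integral_count_space_nat eq)
    finally show ?case ..
  }
qed

section \<open>Superposition of measures\<close>

lemma sets_plus_measure [simp]: "sets (plus_measure \<mu> \<nu>) = sets \<mu>"
  and space_plus_measure [simp]: "space (plus_measure \<mu> \<nu>) = space \<mu>"
  by (simp_all add: plus_measure_def sets.space_closed)

lemma sets_dirac_sum [simp]: "sets (dirac_sum M I x) = sets M"
  and space_dirac_sum [simp]: "space (dirac_sum M I x) = space M"
  by (simp_all add: dirac_sum_def sets.space_closed)

lemma dirac_sum_empty [simp]: "dirac_sum M {} x = null_measure M"
  by (rule measure_eqI) (simp_all add: emeasure_dirac_sum)

lemma plus_measure_null_left [simp]:
  "sets \<mu> = sets M \<Longrightarrow> plus_measure (null_measure M) \<mu> = \<mu>"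
  by (rule measure_eqI) (simp_all add: emeasure_plus_measure)

lemma plus_measure_null_right [simp]:
  "sets \<mu> = sets M \<Longrightarrow> plus_measure \<mu> (null_measure M) = \<mu>"
  by (rule measure_eqI) (simp_all add: emeasure_plus_measure)

lemma plus_measure_assoc:
  assumes "sets \<nu> = sets \<mu>" "sets \<rho> = sets \<mu>"
  shows "plus_measure (plus_measure \<mu> \<nu>) \<rho> = plus_measure \<mu> (plus_measure \<nu> \<rho>)"
  using assms by (intro measure_eqI) (simp_all add: emeasure_plus_measure add.assoc)

lemma plus_measure_right_commute:
  assumes "sets \<nu> = sets \<mu>" "sets \<rho> = sets \<mu>"
  shows "plus_measure (plus_measure \<mu> \<nu>) \<rho> = plus_measure (plus_measure \<mu> \<rho>) \<nu>"
  using assms by (intro measure_eqI) (simp_all add: emeasure_plus_measure add_ac)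

lemma dirac_sum_cong:
  assumes "\<And>i. i \<in> I \<Longrightarrow> x i = y i"
  shows "dirac_sum M I x = dirac_sum M I y"
  using assms by (intro measure_eqI) (auto simp: emeasure_dirac_sum intro!: sum.cong)

lemma dirac_sum_insert:
  assumes "finite I" "i \<notin> I"
  shows "dirac_sum M (insert i I) x = plus_measure (return M (x i)) (dirac_sum M I x)"
  using assms by (intro measure_eqI) (simp_all add: emeasure_dirac_sum emeasure_plus_measure)

lemma nn_integral_plus_measure:
  assumes sets: "sets \<nu> = sets \<mu>" and f: "f \<in> borel_measurable \<mu>"
  shows "integral\<^sup>N (plus_measure \<mu> \<nu>) f = integral\<^sup>N \<mu> f + integral\<^sup>N \<nu> f"
proof -
  \<comment> \<open>A sum of two measures is a series that is continued by zero measures.\<close>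
  define Q where "Q n = (if n = 0 then \<mu> else if n = 1 then \<nu> else null_measure \<mu>)" for n :: nat
  have two: "(\<Sum>n. g (Q n)) = g \<mu> + g \<nu>" if "g (null_measure \<mu>) = 0" for g :: "_ \<Rightarrow> ennreal"
    by (subst suminf_finite[of "{0, 1}"]) (auto simp: Q_def that)
  have "integral\<^sup>N (plus_measure \<mu> \<nu>) f = (\<Sum>n. integral\<^sup>N (Q n) f)"
  proof (rule nn_integral_suminf_measure)
    show "f \<in> borel_measurable (plus_measure \<mu> \<nu>)"
      using f by (simp cong: measurable_cong_sets)
    show "sets (Q n) = sets (plus_measure \<mu> \<nu>)" for n
      by (simp add: Q_def sets)
    show "emeasure (plus_measure \<mu> \<nu>) A = (\<Sum>n. emeasure (Q n) A)"
      if "A \<in> sets (plus_measure \<mu> \<nu>)" for A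
      using that two[of "\<lambda>\<mu>. emeasure \<mu> A"] by (simp add: emeasure_plus_measure sets)
  qed
  then show ?thesis
    using two[of "\<lambda>\<mu>. integral\<^sup>N \<mu> f"] by simp
qed

section \<open>The measurable space of counting measures\<close>

locale localized_space =
  fixes M :: "'a measure" and B :: "nat \<Rightarrow> 'a set"
  assumes localizing: "localizing M B"
    and locally_finite: "locally_finite M B"
begin

abbreviation N :: "'a measure measure" where
  "N \<equiv> counting_algebra M B"

lemma B_sets [measurable, simp]: "B j \<in> sets M"
  and incseq_B: "incseq B"
  and UN_B: "(\<Union>j. B j) = space M"
  using localizing by (auto simp: localizing_def)

lemma space_N: "space N = counting_measures M B"
  unfolding counting_algebra_def by (rule space_measure_of) auto

lemma N_sets: "\<mu> \<in> space N \<Longrightarrow> sets \<mu> = sets M"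
  by (simp add: space_N counting_measures_def)

lemma N_space: "\<mu> \<in> space N \<Longrightarrow> space \<mu> = space M"
  by (auto dest: N_sets sets_eq_imp_space_eq)

lemma in_N_iff:
  "\<mu> \<in> space N \<longleftrightarrow> sets \<mu> = sets M \<and>
    (\<forall>A\<in>bounded_sets M B. emeasure \<mu> A \<in> range (of_nat :: nat \<Rightarrow> ennreal))"
  by (simp add: space_N counting_measures_def)

lemma B_bounded: "B j \<in> bounded_sets M B"
  by (auto simp: bounded_sets_def)

lemma N_bounded_of_nat:
  assumes "\<mu> \<in> space N" "A \<in> bounded_sets M B"
  obtains n :: nat where "emeasure \<mu> A = of_nat n"
  using assms unfolding in_N_iff by blast

lemma emeasure_B_finite: "\<mu> \<in> space N \<Longrightarrow> emeasure \<mu> (B j) \<noteq> \<infinity>"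
  using N_bounded_of_nat[OF _ B_bounded] by (metis ennreal_of_nat_neq_top infinity_ennreal_def)

lemma sigma_finite_N: 
  assumes "\<mu> \<in> space N" shows "sigma_finite_measure \<mu>"
  using UN_B emeasure_B_finite[OF assms]
  by (intro sigma_finite_measure.intro exI[of _ "range B"])
     (auto simp: N_sets[OF assms] N_space[OF assms])

lemma sigma_finite_M: "sigma_finite_measure M"
proof -
  have "emeasure M (B j) \<noteq> \<infinity>" for j
    using locally_finite B_bounded[of j] by (auto simp: locally_finite_def)
  then show ?thesis
    using UN_B by (intro sigma_finite_measure.intro exI[of _ "range B"]) auto
qed

lemma measurable_emeasure_N [measurable (raw)]:
  assumes "A \<in> sets M"
  shows "(\<lambda>\<mu>. emeasure \<mu> A) \<in> borel_measurable N"
proof (rule measurableI)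
  fix U :: "ennreal set" assume "U \<in> sets borel"
  with assms show "(\<lambda>\<mu>. emeasure \<mu> A) -` U \<inter> space N \<in> sets N"
    unfolding space_N unfolding counting_algebra_def by (intro in_measure_of) auto
qed simp

lemma measurable_NI:
  assumes "\<And>\<omega>. \<omega> \<in> space W \<Longrightarrow> f \<omega> \<in> space N"
    and "\<And>A. A \<in> sets M \<Longrightarrow> (\<lambda>\<omega>. emeasure (f \<omega>) A) \<in> borel_measurable W"
  shows "f \<in> measurable W N"
  unfolding counting_algebra_def
proof (rule measurable_measure_of)
  show "f \<in> space W \<rightarrow> counting_measures M B"
    using assms(1) by (auto simp: space_N)
  fix Y assume "Y \<in> {(\<lambda>\<mu>. emeasure \<mu> A) -` U \<inter> counting_measures M B |A U.
    A \<in> sets M \<and> U \<in> sets borel}"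
  then obtain A U where Y: "Y = (\<lambda>\<mu>. emeasure \<mu> A) -` U \<inter> counting_measures M B"
    and A: "A \<in> sets M" and U: "U \<in> sets borel"
    by auto
  have "f -` Y \<inter> space W = (\<lambda>\<omega>. emeasure (f \<omega>) A) -` U \<inter> space W"
    using assms(1) by (auto simp: Y space_N)
  then show "f -` Y \<inter> space W \<in> sets W"
    using measurable_sets[OF assms(2)[OF A] U] by simp
qed auto

lemma emeasure_measurable_compose [measurable (raw)]:
  assumes "f \<in> measurable W N" "A \<in> sets M"
  shows "(\<lambda>\<omega>. emeasure (f \<omega>) A) \<in> borel_measurable W"
  using measurable_compose[OF assms(1) measurable_emeasure_N[OF assms(2)]] .

lemma null_in_N [simp]: "null_measure M \<in> space N"
  by (auto simp: in_N_iff intro: range_eqI[of _ _ 0])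

lemma plus_in_N:
  assumes "\<mu> \<in> space N" "\<nu> \<in> space N"
  shows "plus_measure \<mu> \<nu> \<in> space N"
  unfolding in_N_iff
proof (intro conjI ballI)
  fix A assume A: "A \<in> bounded_sets M B"
  then obtain m n :: nat where "emeasure \<mu> A = of_nat m" "emeasure \<nu> A = of_nat n"
    using assms N_bounded_of_nat by metis
  then show "emeasure (plus_measure \<mu> \<nu>) A \<in> range of_nat"
    using A assms by (auto simp: emeasure_plus_measure N_sets bounded_sets_def
        simp flip: of_nat_add)
qed (simp add: assms N_sets)

lemma dirac_sum_in_N: "finite I \<Longrightarrow> dirac_sum M I x \<in> space N"
proof -
  have "(\<Sum>i\<in>I. indicator A (x i)) = (of_nat (\<Sum>i\<in>I. indicator A (x i)) :: ennreal)" for A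
    by (auto simp: indicator_def intro!: sum.cong)
  then show ?thesis
    by (auto simp: in_N_iff emeasure_dirac_sum bounded_sets_def simp del: of_nat_sum)
qed

lemma return_in_N: "return M x \<in> space N"
proof -
  have "indicator A x = (of_nat (indicator A x) :: ennreal)" for A
    by (auto simp: indicator_def)
  then show ?thesis
    by (auto simp: in_N_iff bounded_sets_def)
qed

lemma measurable_plus_measure [measurable (raw)]:
  assumes [measurable]: "f \<in> measurable W N" "g \<in> measurable W N"
  shows "(\<lambda>\<omega>. plus_measure (f \<omega>) (g \<omega>)) \<in> measurable W N"
proof (rule measurable_NI)
  have fg: "f \<omega> \<in> space N" "g \<omega> \<in> space N" if "\<omega> \<in> space W" for \<omega>
    using that assms[THEN measurable_space] by auto
  show "plus_measure (f \<omega>) (g \<omega>) \<in> space N" if "\<omega> \<in> space W" for \<omega>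
    using fg[OF that] by (rule plus_in_N)
  show "(\<lambda>\<omega>. emeasure (plus_measure (f \<omega>) (g \<omega>)) A) \<in> borel_measurable W"
    if [measurable]: "A \<in> sets M" for A
  proof -
    have "(\<lambda>\<omega>. emeasure (f \<omega>) A + emeasure (g \<omega>) A) \<in> borel_measurable W"
      by measurable
    then show ?thesis
      by (rule measurable_cong[THEN iffD1, rotated])
         (use fg in \<open>simp add: emeasure_plus_measure N_sets\<close>)
  qed
qed

lemma measurable_return_N [measurable]: "return M \<in> measurable M N"
  by (rule measurable_NI) (auto simp: return_in_N)

lemma measurable_dirac_sum [measurable (raw)]:
  assumes "finite I" "I \<subseteq> J"
  shows "dirac_sum M I \<in> measurable (\<Pi>\<^sub>M i\<in>J. M) N"
proof (rule measurable_NI)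
  show "(\<lambda>x. emeasure (dirac_sum M I x) A) \<in> borel_measurable (\<Pi>\<^sub>M i\<in>J. M)"
    if [measurable]: "A \<in> sets M" for A
  proof -
    have "(\<lambda>x. indicator A (x i) :: ennreal) \<in> borel_measurable (\<Pi>\<^sub>M i\<in>J. M)" if "i \<in> I" for i
    proof -
      have "i \<in> J" using that assms by auto
      then show ?thesis by measurable
    qed
    then show ?thesis
      by (simp add: emeasure_dirac_sum that)
  qed
qed (use assms dirac_sum_in_N in auto)

text \<open>
  The whole space need not be bounded, so integrality has to come from the sets \<open>B j\<close>: the total
  mass is the supremum of the integers \<open>\<mu> (B j)\<close>, and a bounded increasing sequence of integers is
  eventually constant.
\<close>

lemma total_mass_of_nat:
  assumes \<mu>: "\<mu> \<in> space N" and fin: "emeasure \<mu> (space M) \<noteq> \<infinity>"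
  shows "\<exists>n. emeasure \<mu> (space M) = of_nat n"
proof -
  have "\<forall>j. \<exists>n. emeasure \<mu> (B j) = of_nat n"
    using N_bounded_of_nat[OF \<mu> B_bounded] by metis
  then obtain n where n: "\<And>j. emeasure \<mu> (B j) = of_nat (n j)"
    by metis
  have SUP: "emeasure \<mu> (space M) = (SUP j. of_nat (n j))"
    using SUP_emeasure_incseq[of B \<mu>] incseq_B UN_B \<mu> by (auto simp: N_sets n image_subset_iff)
  obtain b where b: "emeasure \<mu> (space M) < of_nat b"
    using fin ennreal_Ex_less_of_nat by (auto simp: less_top)
  have "n j \<le> b" for j
  proof -
    have "(of_nat (n j) :: ennreal) \<le> emeasure \<mu> (space M)"
      unfolding SUP by (rule SUP_upper) simp
    also note b
    finally show ?thesis by simp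
  qed
  then have finite_range: "finite (range n)"
    by (auto intro: finite_subset[of _ "{..b}"])
  then have "Max (range n) \<in> range n"
    by (intro Max_in) auto
  then obtain k where k: "n k = Max (range n)" by auto
  have "(SUP j. of_nat (n j) :: ennreal) = of_nat (n k)"
    by (intro antisym SUP_least SUP_upper) (auto simp: k finite_range)
  with SUP show ?thesis by auto
qed

lemma eq_null_measure:
  assumes "\<mu> \<in> space N" "emeasure \<mu> (space M) = 0"
  shows "\<mu> = null_measure M"
proof (rule measure_eqI)
  show "emeasure \<mu> A = emeasure (null_measure M) A" if "A \<in> sets \<mu>" for A
    using emeasure_space[of \<mu> A] assms by (simp add: N_space)
qed (simp add: assms N_sets)

text \<open>
  In a general measurable space counting measures need not be sums of Dirac measures, so the integral
  cannot be treated as a sum over points. For indicators of rectangles this is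
  the measurability of \<open>\<mu> \<mapsto> \<mu>(A)\<close>; a Dynkin argument covers the remaining sets,
  and it is applied on each \<open>B j\<close> because complements need finite measure.
\<close>

lemma measurable_integral_self:
  assumes "f \<in> borel_measurable (M \<Otimes>\<^sub>M N)"
  shows "(\<lambda>\<mu>. \<integral>\<^sup>+x. f (x, \<mu>) \<partial>\<mu>) \<in> borel_measurable N"
proof -
  have section_sets: "(\<lambda>x. (x, \<mu>)) -` E \<inter> space M \<in> sets M"
    if "E \<in> sets (M \<Otimes>\<^sub>M N)" "\<mu> \<in> space N" for E \<mu>
    using measurable_sets[OF measurable_Pair2'[OF that(2)] that(1)] .
  let ?s = "\<lambda>j E \<mu>. emeasure \<mu> (B j \<inter> ((\<lambda>x. (x, \<mu>)) -` E \<inter> space M))"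
  have cut: "?s j E \<in> borel_measurable N" if "E \<in> sets (M \<Otimes>\<^sub>M N)" for j E
    using Int_stable_pair_measure_generator pair_measure_closed that
    unfolding sets_pair_measure
  proof (induct rule: sigma_sets_induct_disjoint)
    case (basic E)
    then obtain A U where E: "E = A \<times> U" and [measurable]: "A \<in> sets M" "U \<in> sets N"
      by auto
    have "?s j E \<mu> = emeasure \<mu> (B j \<inter> A) * indicator U \<mu>" for \<mu>
      using sets.sets_into_space[OF \<open>A \<in> sets M\<close>]
      by (auto simp: E indicator_def intro!: arg_cong[where f="emeasure \<mu>"])
    then show ?case
      by simp
  next
    case (compl E)
    then have E: "E \<in> sets (M \<Otimes>\<^sub>M N)"
      by (simp add: sets_pair_measure)
    have eq: "emeasure \<mu> (B j) - ?s j E \<mu> = ?s j (space M \<times> space N - E) \<mu>" if \<mu>: "\<mu> \<in> space N" for \<mu>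
    proof -
      have "B j \<subseteq> space M"
        by (rule sets.sets_into_space) simp
      then have "B j \<inter> ((\<lambda>x. (x, \<mu>)) -` (space M \<times> space N - E) \<inter> space M)
          = B j - B j \<inter> ((\<lambda>x. (x, \<mu>)) -` E \<inter> space M)"
        using \<mu> by auto
      moreover have "emeasure \<mu> (B j \<inter> ((\<lambda>x. (x, \<mu>)) -` E \<inter> space M)) \<le> emeasure \<mu> (B j)"
        using \<mu> by (intro emeasure_mono) (auto simp: N_sets)
      then have "emeasure \<mu> (B j \<inter> ((\<lambda>x. (x, \<mu>)) -` E \<inter> space M)) \<noteq> \<infinity>"
        using emeasure_B_finite[OF \<mu>, of j] by (auto simp: top_unique)
      ultimately show ?thesis
        using section_sets[OF E \<mu>] \<mu> by (simp add: emeasure_Diff N_sets sets.Int)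
    qed
    show ?case
      by (rule measurable_cong[THEN iffD1, OF eq], assumption)
         (use compl in measurable)
  next
    case (union F)
    then have F: "F i \<in> sets (M \<Otimes>\<^sub>M N)" for i
      by (auto simp: sets_pair_measure)
    have eq: "(\<Sum>i. ?s j (F i) \<mu>) = ?s j (\<Union>i. F i) \<mu>" if \<mu>: "\<mu> \<in> space N" for \<mu>
    proof -
      have "(\<Sum>i. ?s j (F i) \<mu>) = emeasure \<mu> (\<Union>i. B j \<inter> ((\<lambda>x. (x, \<mu>)) -` F i \<inter> space M))"
      proof (rule suminf_emeasure)
        show "range (\<lambda>i. B j \<inter> ((\<lambda>x. (x, \<mu>)) -` F i \<inter> space M)) \<subseteq> sets \<mu>"
          using section_sets[OF F \<mu>] \<mu> by (auto simp: N_sets intro!: sets.Int[OF B_sets])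
        show "disjoint_family (\<lambda>i. B j \<inter> ((\<lambda>x. (x, \<mu>)) -` F i \<inter> space M))"
          using union(1) by (fastforce simp: disjoint_family_on_def)
      qed
      also have "(\<Union>i. B j \<inter> ((\<lambda>x. (x, \<mu>)) -` F i \<inter> space M))
          = B j \<inter> ((\<lambda>x. (x, \<mu>)) -` (\<Union>i. F i) \<inter> space M)"
        by auto
      finally show ?thesis .
    qed
    show ?case
      by (rule measurable_cong[THEN iffD1, OF eq], assumption)
         (use union in measurable)
  qed simp
  show ?thesis
    using assms
  proof (induction rule: borel_measurable_induct)
    have *: "(\<lambda>x. u (x, \<mu>)) \<in> borel_measurable \<mu>"
      if "u \<in> borel_measurable (M \<Otimes>\<^sub>M N)" "\<mu> \<in> space N" for u :: "_ \<Rightarrow> ennreal" and \<mu>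
      using measurable_compose[OF measurable_Pair2'[OF that(2)] that(1)] N_sets[OF that(2)]
      by (simp cong: measurable_cong_sets)
    {
      case (cong f g)
      have "(\<integral>\<^sup>+x. f (x, \<mu>) \<partial>\<mu>) = (\<integral>\<^sup>+x. g (x, \<mu>) \<partial>\<mu>)" if "\<mu> \<in> space N" for \<mu>
        using that cong(3) by (intro nn_integral_cong) (auto simp: space_pair_measure N_space)
      with cong(4) show ?case
        by (simp cong: measurable_cong)
    next
      case (set E)
      have "(\<integral>\<^sup>+x. indicator E (x, \<mu>) \<partial>\<mu>) = (SUP j. ?s j E \<mu>)" if \<mu>: "\<mu> \<in> space N" for \<mu>
      proof -
        have "(\<integral>\<^sup>+x. indicator E (x, \<mu>) \<partial>\<mu>)
            = (\<integral>\<^sup>+x. indicator ((\<lambda>x. (x, \<mu>)) -` E \<inter> space M) x \<partial>\<mu>)"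
          using \<mu> by (intro nn_integral_cong) (auto simp: N_space indicator_def)
        also have "\<dots> = emeasure \<mu> ((\<lambda>x. (x, \<mu>)) -` E \<inter> space M)"
          using section_sets[OF set \<mu>] \<mu> by (simp add: N_sets)
        also have "(\<lambda>x. (x, \<mu>)) -` E \<inter> space M = (\<Union>j. B j \<inter> ((\<lambda>x. (x, \<mu>)) -` E \<inter> space M))"
          using UN_B by auto
        also have "emeasure \<mu> \<dots> = (SUP j. ?s j E \<mu>)"
          using section_sets[OF set \<mu>] \<mu> incseq_B
          by (intro SUP_emeasure_incseq[symmetric])
             (auto simp: N_sets incseq_def intro!: sets.Int)
        finally show ?thesis .
      qed
      then show ?case
        using cut[OF set] by (simp cong: measurable_cong)
    next
      case (mult u c)
      then show ?case
        by (simp add: nn_integral_cmult * cong: measurable_cong)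
    next
      case (add u v)
      then show ?case
        by (simp add: nn_integral_add * cong: measurable_cong)
    next
      case (seq U)
      have "(\<integral>\<^sup>+x. (\<Squnion>(range U)) (x, \<mu>) \<partial>\<mu>) = (SUP i. \<integral>\<^sup>+x. U i (x, \<mu>) \<partial>\<mu>)" if \<mu>: "\<mu> \<in> space N" for \<mu>
      proof -
        have "(\<integral>\<^sup>+x. (\<Squnion>(range U)) (x, \<mu>) \<partial>\<mu>) = (\<integral>\<^sup>+x. (SUP i. U i (x, \<mu>)) \<partial>\<mu>)"
          by (simp add: image_comp)
        also have "\<dots> = (SUP i. \<integral>\<^sup>+x. U i (x, \<mu>) \<partial>\<mu>)"
          using seq \<mu> by (intro nn_integral_monotone_convergence_SUP * )
            (auto simp: incseq_def le_fun_def)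
        finally show ?thesis .
      qed
      with seq show ?case
        by (simp cong: measurable_cong)
    }
  qed
qed

end

section \<open>Adding points with a given intensity\<close>

locale intensity_space = localized_space M B for M :: "'a measure" and B :: "nat \<Rightarrow> 'a set" +
  fixes \<kappa> :: "'a \<Rightarrow> 'a measure \<Rightarrow> ennreal"
  assumes intensity: "intensity M B \<kappa>"
begin

text \<open>
  \<open>insertion\<close> is the inner integral on the right-hand side of the Gibbs equation. \<open>growth\<close> is the
  case in which the integrand ignores which point was added; it is the operator that is iterated.
  \<open>gibbs_weight\<close> is the unnormalized integral against the Gibbs law; its term for \<open>n = 0\<close> is the
  value at the empty configuration.
\<close>

definition insertion :: "('a \<times> 'a measure \<Rightarrow> ennreal) \<Rightarrow> 'a measure \<Rightarrow> ennreal" where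
  "insertion f \<mu> = (\<integral>\<^sup>+x. f (x, plus_measure \<mu> (return M x)) * \<kappa> x \<mu> \<partial>M)"

definition growth :: "('a measure \<Rightarrow> ennreal) \<Rightarrow> 'a measure \<Rightarrow> ennreal" where
  "growth g = insertion (\<lambda>(x, \<mu>). g \<mu>)"

definition gibbs_weight :: "('a measure \<Rightarrow> ennreal) \<Rightarrow> ennreal" where
  "gibbs_weight g = (\<Sum>n. ennreal (1 / fact n) * (growth ^^ n) g (null_measure M))"

lemma growth_eq: "growth g \<mu> = (\<integral>\<^sup>+x. g (plus_measure \<mu> (return M x)) * \<kappa> x \<mu> \<partial>M)"
  by (simp add: growth_def insertion_def)

lemma measurable_intensity [measurable (raw)]:
  assumes "f \<in> measurable W M" "g \<in> measurable W N"
  shows "(\<lambda>\<omega>. \<kappa> (f \<omega>) (g \<omega>)) \<in> borel_measurable W"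
proof -
  have "(\<lambda>(x, \<mu>). \<kappa> x \<mu>) \<in> borel_measurable (M \<Otimes>\<^sub>M N)"
    using intensity by (simp add: intensity_def)
  from measurable_compose[OF measurable_Pair[OF assms] this] show ?thesis
    by simp
qed

lemma measurable_insertion [measurable (raw)]:
  assumes [measurable]: "f \<in> borel_measurable (M \<Otimes>\<^sub>M N)"
  shows "insertion f \<in> borel_measurable N"
proof -
  interpret sigma_finite_measure M by (rule sigma_finite_M)
  show ?thesis
    unfolding insertion_def by measurable
qed

lemma measurable_growth:
  assumes [measurable]: "g \<in> borel_measurable N"
  shows "growth g \<in> borel_measurable N"
  unfolding growth_def by measurable

lemma measurable_growth_funpow:
  "g \<in> borel_measurable N \<Longrightarrow> (growth ^^ n) g \<in> borel_measurable N"
  by (induction n) (simp_all add: measurable_growth)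

lemma measurable_kappa_m:
  assumes \<mu>: "\<mu> \<in> space N"
  shows "(\<lambda>x. kappa_m M \<kappa> n x \<mu>) \<in> borel_measurable (\<Pi>\<^sub>M i\<in>{1..n}. M)"
  unfolding kappa_m_def
proof (rule borel_measurable_prod_ennreal)
  fix i assume i: "i \<in> {1..n}"
  have [measurable]: "dirac_sum M {i<..n} \<in> measurable (\<Pi>\<^sub>M i\<in>{1..n}. M) N"
    by (rule measurable_dirac_sum) (use i in auto)
  show "(\<lambda>x. \<kappa> (x i) (plus_measure \<mu> (dirac_sum M {i<..n} x))) \<in> borel_measurable (\<Pi>\<^sub>M i\<in>{1..n}. M)"
    using i \<mu> by measurable
qed

text \<open>
  The last coordinate is the point that is added first: it is weighted by the intensity at \<open>\<mu>\<close>, and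
  all other points are added to \<open>\<mu> + \<delta>\<^sub>y\<close>. This is what makes \<open>kappa_m\<close> the density of iterated
  \<open>growth\<close>.
\<close>

lemma kappa_m_Suc:
  assumes \<mu>: "\<mu> \<in> space N"
  shows "kappa_m M \<kappa> (Suc n) (x(Suc n := y)) \<mu>
    = kappa_m M \<kappa> n x (plus_measure \<mu> (return M y)) * \<kappa> y \<mu>"
proof -
  have tail: "plus_measure \<mu> (dirac_sum M {i<..Suc n} (x(Suc n := y)))
      = plus_measure (plus_measure \<mu> (return M y)) (dirac_sum M {i<..n} x)" if "i \<le> n" for i
  proof -
    have "{i<..Suc n} = insert (Suc n) {i<..n}"
      using that by auto
    moreover have "dirac_sum M {i<..n} (x(Suc n := y)) = dirac_sum M {i<..n} x"
      by (rule dirac_sum_cong) auto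
    ultimately show ?thesis
      by (simp add: dirac_sum_insert plus_measure_assoc N_sets[OF \<mu>])
  qed
  have "kappa_m M \<kappa> (Suc n) (x(Suc n := y)) \<mu> =
      (\<Prod>i=1..n. \<kappa> ((x(Suc n := y)) i) (plus_measure \<mu> (dirac_sum M {i<..Suc n} (x(Suc n := y)))))
      * \<kappa> y \<mu>"
    by (simp add: kappa_m_def N_sets[OF \<mu>])
  also have "(\<Prod>i=1..n. \<kappa> ((x(Suc n := y)) i) (plus_measure \<mu> (dirac_sum M {i<..Suc n} (x(Suc n := y)))))
      = kappa_m M \<kappa> n x (plus_measure \<mu> (return M y))"
    unfolding kappa_m_def by (intro prod.cong refl) (simp add: tail)
  finally show ?thesis .
qed

text \<open>
  Besides identifying the weight with the series of the partition function, this integral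
  representation gives linearity of the iterates at once.
\<close>

lemma growth_funpow_eq:
  assumes g [measurable]: "g \<in> borel_measurable N" and \<mu>: "\<mu> \<in> space N"
  shows "(growth ^^ n) g \<mu> = (\<integral>\<^sup>+x. g (plus_measure \<mu> (dirac_sum M {1..n} x)) * kappa_m M \<kappa> n x \<mu>
    \<partial>(\<Pi>\<^sub>M i\<in>{1..n}. M))"
  using \<mu>
proof (induction n arbitrary: \<mu>)
  case 0
  then show ?case
    by (simp add: PiM_empty nn_integral_count_space_finite N_sets kappa_m_def)
next
  case (Suc n)
  note \<mu> [simp] = Suc.prems
  interpret product_sigma_finite "\<lambda>_::nat. M"
    by (rule product_sigma_finite.intro) (rule sigma_finite_M)
  have [measurable]: "dirac_sum M {1..m} \<in> measurable (\<Pi>\<^sub>M i\<in>{1..m}. M) N" for m :: nat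
    by (rule measurable_dirac_sum) simp_all
  note [measurable] = measurable_kappa_m[OF \<mu>]
  let ?F = "\<lambda>x. g (plus_measure \<mu> (dirac_sum M {1..Suc n} x)) * kappa_m M \<kappa> (Suc n) x \<mu>"
  have split: "{1..Suc n} = insert (Suc n) {1..n}"
    by auto
  have F: "?F \<in> borel_measurable (\<Pi>\<^sub>M i\<in>{1..Suc n}. M)"
    by measurable
  have step: "(growth ^^ n) g (plus_measure \<mu> (return M y)) * \<kappa> y \<mu>
      = (\<integral>\<^sup>+x. ?F (x(Suc n := y)) \<partial>(\<Pi>\<^sub>M i\<in>{1..n}. M))" for y
  proof -
    let ?\<nu> = "plus_measure \<mu> (return M y)"
    have \<nu> [simp]: "?\<nu> \<in> space N"
      by (simp add: plus_in_N return_in_N)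
    note [measurable] = measurable_kappa_m[OF \<nu>]
    have "dirac_sum M {1..n} (x(Suc n := y)) = dirac_sum M {1..n} x" for x
      by (rule dirac_sum_cong) auto
    then have tail: "plus_measure \<mu> (dirac_sum M {1..Suc n} (x(Suc n := y)))
        = plus_measure ?\<nu> (dirac_sum M {1..n} x)" for x
      unfolding split by (simp add: dirac_sum_insert plus_measure_assoc N_sets[OF \<mu>])
    show ?thesis
      unfolding Suc.IH[OF \<nu>] kappa_m_Suc[OF \<mu>] tail mult.assoc[symmetric]
      by (rule nn_integral_multc[symmetric]) measurable
  qed
  have "(growth ^^ Suc n) g \<mu>
      = (\<integral>\<^sup>+y. (growth ^^ n) g (plus_measure \<mu> (return M y)) * \<kappa> y \<mu> \<partial>M)"
    by (simp add: growth_eq[of "(growth ^^ n) g"])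
  also have "\<dots> = (\<integral>\<^sup>+y. \<integral>\<^sup>+x. ?F (x(Suc n := y)) \<partial>(\<Pi>\<^sub>M i\<in>{1..n}. M) \<partial>M)"
    by (simp only: step)
  also have "\<dots> = integral\<^sup>N (\<Pi>\<^sub>M i\<in>{1..Suc n}. M) ?F"
    unfolding split by (rule product_nn_integral_insert_rev[symmetric]) (use F split in auto)
  finally show ?case .
qed

lemma growth_funpow_cong:
  assumes "\<And>\<mu>. \<mu> \<in> space N \<Longrightarrow> g \<mu> = h \<mu>" "\<mu> \<in> space N"
  shows "(growth ^^ n) g \<mu> = (growth ^^ n) h \<mu>"
  using assms(2)
proof (induction n arbitrary: \<mu>)
  case (Suc n)
  then have "(growth ^^ n) g (plus_measure \<mu> (return M x))
      = (growth ^^ n) h (plus_measure \<mu> (return M x))" for x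
    by (simp add: plus_in_N return_in_N)
  then show ?case
    by (simp add: growth_eq[of "(growth ^^ n) _"])
qed (simp add: assms(1))

lemma growth_funpow_add:
  assumes [measurable]: "g \<in> borel_measurable N" "h \<in> borel_measurable N" and \<mu>: "\<mu> \<in> space N"
  shows "(growth ^^ n) (\<lambda>\<mu>. g \<mu> + h \<mu>) \<mu> = (growth ^^ n) g \<mu> + (growth ^^ n) h \<mu>"
proof -
  have [measurable]: "dirac_sum M {1..n} \<in> measurable (\<Pi>\<^sub>M i\<in>{1..n}. M) N"
    by (rule measurable_dirac_sum) simp_all
  note [measurable] = measurable_kappa_m[OF \<mu>]
  have "\<mu> \<in> space N" by fact
  then show ?thesis
    by (simp add: growth_funpow_eq distrib_right nn_integral_add del: One_nat_def)
qed

section \<open>The law of a finite Gibbs process\<close>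

definition level :: "nat \<Rightarrow> 'a measure set" where
  "level n = {\<mu> \<in> space N. emeasure \<mu> (space M) = of_nat n}"

lemma level_sets [measurable]: "level n \<in> sets N"
  unfolding level_def by measurable

text \<open>
  The factor \<open>Suc n\<close> is the total mass: the integrand given to the Gibbs equation depends on \<open>\<mu>\<close>
  alone, so its integral against \<open>\<mu>\<close> multiplies it by the mass of \<open>\<mu>\<close>.
\<close>

lemma gibbs_level_step:
  assumes gibbs: "gibbs_process M B \<kappa> \<Omega> \<eta>" and g [measurable]: "g \<in> borel_measurable N"
  shows "of_nat (Suc n) * (\<integral>\<^sup>+\<omega>. g (\<eta> \<omega>) * indicator (level (Suc n)) (\<eta> \<omega>) \<partial>\<Omega>)
    = (\<integral>\<^sup>+\<omega>. growth g (\<eta> \<omega>) * indicator (level n) (\<eta> \<omega>) \<partial>\<Omega>)"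
proof -
  have \<eta> [measurable]: "\<eta> \<in> measurable \<Omega> N"
    using gibbs by (simp add: gibbs_process_def point_process_def)
  let ?f = "\<lambda>(x :: 'a, \<mu>). g \<mu> * indicator (level (Suc n)) \<mu>"
  have N: "\<eta> \<omega> \<in> space N" if "\<omega> \<in> space \<Omega>" for \<omega>
    using measurable_space[OF \<eta> that] .
  have "of_nat (Suc n) * (\<integral>\<^sup>+\<omega>. g (\<eta> \<omega>) * indicator (level (Suc n)) (\<eta> \<omega>) \<partial>\<Omega>)
      = (\<integral>\<^sup>+\<omega>. of_nat (Suc n) * (g (\<eta> \<omega>) * indicator (level (Suc n)) (\<eta> \<omega>)) \<partial>\<Omega>)"
    by (rule nn_integral_cmult[symmetric]) measurable
  also have "\<dots> = (\<integral>\<^sup>+\<omega>. (\<integral>\<^sup>+x. ?f (x, \<eta> \<omega>) \<partial>(\<eta> \<omega>)) \<partial>\<Omega>)"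
    using N by (intro nn_integral_cong)
      (auto simp: N_space level_def mult_ac split: split_indicator)
  also have "\<dots> = (\<integral>\<^sup>+\<omega>. (\<integral>\<^sup>+x. ?f (x, plus_measure (\<eta> \<omega>) (return M x)) * \<kappa> x (\<eta> \<omega>) \<partial>M) \<partial>\<Omega>)"
  proof -
    have "?f \<in> borel_measurable (M \<Otimes>\<^sub>M N)"
      by measurable
    then show ?thesis
      using gibbs unfolding gibbs_process_def by blast
  qed
  also have "\<dots> = (\<integral>\<^sup>+\<omega>. growth g (\<eta> \<omega>) * indicator (level n) (\<eta> \<omega>) \<partial>\<Omega>)"
  proof (rule nn_integral_cong)
    fix \<omega> assume \<omega>: "\<omega> \<in> space \<Omega>"
    note \<mu> = N[OF \<omega>]
    have level: "indicator (level (Suc n)) (plus_measure (\<eta> \<omega>) (return M x))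
        = (indicator (level n) (\<eta> \<omega>) :: ennreal)" if x: "x \<in> space M" for x
    proof -
      have "emeasure (plus_measure (\<eta> \<omega>) (return M x)) (space M) = emeasure (\<eta> \<omega>) (space M) + 1"
        using x \<mu> by (simp add: emeasure_plus_measure N_sets)
      moreover have "emeasure (\<eta> \<omega>) (space M) + 1 = of_nat (Suc n)
          \<longleftrightarrow> emeasure (\<eta> \<omega>) (space M) = of_nat n"
        using ennreal_add_left_cancel[of 1 "emeasure (\<eta> \<omega>) (space M)" "of_nat n"]
        by (simp add: add.commute)
      ultimately show ?thesis
        using \<mu> by (simp add: level_def plus_in_N return_in_N indicator_def)
    qed
    have "(\<integral>\<^sup>+x. ?f (x, plus_measure (\<eta> \<omega>) (return M x)) * \<kappa> x (\<eta> \<omega>) \<partial>M)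
        = (\<integral>\<^sup>+x. (g (plus_measure (\<eta> \<omega>) (return M x)) * \<kappa> x (\<eta> \<omega>)) * indicator (level n) (\<eta> \<omega>) \<partial>M)"
      by (intro nn_integral_cong) (simp add: level mult_ac)
    also have "\<dots> = growth g (\<eta> \<omega>) * indicator (level n) (\<eta> \<omega>)"
      unfolding growth_eq using \<mu> by (intro nn_integral_multc) measurable
    finally show "(\<integral>\<^sup>+x. ?f (x, plus_measure (\<eta> \<omega>) (return M x)) * \<kappa> x (\<eta> \<omega>) \<partial>M)
        = growth g (\<eta> \<omega>) * indicator (level n) (\<eta> \<omega>)" .
  qed
  finally show ?thesis .
qed

text \<open>
  Iterating the previous step down to mass zero leaves only the zero measure, where every function
  is a constant.
\<close>

lemma gibbs_level:
  assumes gibbs: "gibbs_process M B \<kappa> \<Omega> \<eta>" and "g \<in> borel_measurable N"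
  shows "fact n * (\<integral>\<^sup>+\<omega>. g (\<eta> \<omega>) * indicator (level n) (\<eta> \<omega>) \<partial>\<Omega>)
    = emeasure \<Omega> (\<eta> -` level 0 \<inter> space \<Omega>) * (growth ^^ n) g (null_measure M)"
  using assms(2)
proof (induction n arbitrary: g)
  have \<eta> [measurable]: "\<eta> \<in> measurable \<Omega> N"
    using gibbs by (simp add: gibbs_process_def point_process_def)
  {
    case 0
    have "(\<integral>\<^sup>+\<omega>. g (\<eta> \<omega>) * indicator (level 0) (\<eta> \<omega>) \<partial>\<Omega>)
        = (\<integral>\<^sup>+\<omega>. g (null_measure M) * indicator (\<eta> -` level 0 \<inter> space \<Omega>) \<omega> \<partial>\<Omega>)"
    proof (rule nn_integral_cong)
      fix \<omega> assume "\<omega> \<in> space \<Omega>"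
      then show "g (\<eta> \<omega>) * indicator (level 0) (\<eta> \<omega>)
          = g (null_measure M) * indicator (\<eta> -` level 0 \<inter> space \<Omega>) \<omega>"
        using eq_null_measure[of "\<eta> \<omega>"] by (cases "\<eta> \<omega> \<in> level 0") (auto simp: level_def)
    qed
    also have "\<dots> = g (null_measure M) * emeasure \<Omega> (\<eta> -` level 0 \<inter> space \<Omega>)"
      by (rule nn_integral_cmult_indicator) measurable
    finally show ?case
      by (simp add: mult.commute)
  next
    case (Suc n)
    have "fact (Suc n) * (\<integral>\<^sup>+\<omega>. g (\<eta> \<omega>) * indicator (level (Suc n)) (\<eta> \<omega>) \<partial>\<Omega>)
        = fact n * (of_nat (Suc n) * (\<integral>\<^sup>+\<omega>. g (\<eta> \<omega>) * indicator (level (Suc n)) (\<eta> \<omega>) \<partial>\<Omega>))"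
      by (simp add: mult_ac)
    also have "\<dots> = fact n * (\<integral>\<^sup>+\<omega>. growth g (\<eta> \<omega>) * indicator (level n) (\<eta> \<omega>) \<partial>\<Omega>)"
      by (simp only: gibbs_level_step[OF gibbs Suc.prems])
    also have "\<dots> = emeasure \<Omega> (\<eta> -` level 0 \<inter> space \<Omega>) * (growth ^^ Suc n) g (null_measure M)"
      unfolding Suc.IH[OF measurable_growth[OF Suc.prems]] funpow_Suc_right comp_def ..
    finally show ?case .
  }
qed

lemma finite_gibbs_expectation:
  assumes gibbs: "finite_gibbs_process M B \<kappa> \<Omega> \<eta>" and g [measurable]: "g \<in> borel_measurable N"
  shows "(\<integral>\<^sup>+\<omega>. g (\<eta> \<omega>) \<partial>\<Omega>) = emeasure \<Omega> (\<eta> -` level 0 \<inter> space \<Omega>) * gibbs_weight g"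
proof -
  have gp: "gibbs_process M B \<kappa> \<Omega> \<eta>" and fin: "AE \<omega> in \<Omega>. finite_measure (\<eta> \<omega>)"
    using gibbs by (auto simp: finite_gibbs_process_def)
  have \<eta> [measurable]: "\<eta> \<in> measurable \<Omega> N"
    using gp by (simp add: gibbs_process_def point_process_def)
  let ?p = "emeasure \<Omega> (\<eta> -` level 0 \<inter> space \<Omega>)"
  have "(\<integral>\<^sup>+\<omega>. g (\<eta> \<omega>) \<partial>\<Omega>) = (\<integral>\<^sup>+\<omega>. (\<Sum>n. g (\<eta> \<omega>) * indicator (level n) (\<eta> \<omega>)) \<partial>\<Omega>)"
  proof (rule nn_integral_cong_AE)
    show "AE \<omega> in \<Omega>. g (\<eta> \<omega>) = (\<Sum>n. g (\<eta> \<omega>) * indicator (level n) (\<eta> \<omega>))"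
      using fin
    proof (rule AE_mp, intro AE_I2 impI)
      fix \<omega> assume \<omega>: "\<omega> \<in> space \<Omega>" and "finite_measure (\<eta> \<omega>)"
      then interpret finite_measure "\<eta> \<omega>" by simp
      have \<mu>: "\<eta> \<omega> \<in> space N"
        using measurable_space[OF \<eta> \<omega>] .
      have "emeasure (\<eta> \<omega>) (space M) \<noteq> \<infinity>"
        using emeasure_finite by simp
      then obtain k where k: "emeasure (\<eta> \<omega>) (space M) = of_nat k"
        using total_mass_of_nat[OF \<mu>] by blast
      have "(\<Sum>n. g (\<eta> \<omega>) * indicator (level n) (\<eta> \<omega>))
          = (\<Sum>n\<in>{k}. g (\<eta> \<omega>) * indicator (level n) (\<eta> \<omega>))"
        by (rule suminf_finite) (auto simp: level_def k)
      then show "g (\<eta> \<omega>) = (\<Sum>n. g (\<eta> \<omega>) * indicator (level n) (\<eta> \<omega>))"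
        using \<mu> k by (simp add: level_def)
    qed
  qed
  also have "\<dots> = (\<Sum>n. \<integral>\<^sup>+\<omega>. g (\<eta> \<omega>) * indicator (level n) (\<eta> \<omega>) \<partial>\<Omega>)"
    by (rule nn_integral_suminf) measurable
  also have "\<dots> = (\<Sum>n. ?p * (ennreal (1 / fact n) * (growth ^^ n) g (null_measure M)))"
  proof (rule suminf_cong)
    fix n
    let ?E = "\<integral>\<^sup>+\<omega>. g (\<eta> \<omega>) * indicator (level n) (\<eta> \<omega>) \<partial>\<Omega>"
    have one: "ennreal (1 / fact n) * fact n = 1"
    proof -
      have "(fact n :: ennreal) = ennreal (fact n)"
        by (metis ennreal_of_nat_eq_real_of_nat of_nat_fact)
      then show ?thesis
        by (simp flip: ennreal_mult)
    qed
    have "?E = (ennreal (1 / fact n) * fact n) * ?E"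
      by (simp add: one)
    also have "\<dots> = ennreal (1 / fact n) * (fact n * ?E)"
      by (simp add: mult.assoc)
    also have "\<dots> = ?p * (ennreal (1 / fact n) * (growth ^^ n) g (null_measure M))"
      unfolding gibbs_level[OF gp g] by (simp add: mult_ac)
    finally show "?E = ?p * (ennreal (1 / fact n) * (growth ^^ n) g (null_measure M))" .
  qed
  also have "\<dots> = ?p * gibbs_weight g"
    by (simp add: gibbs_weight_def)
  finally show ?thesis .
qed

text \<open>
  The constant \<open>1\<close> in \<open>finite_gibbs_expectation\<close> gives \<open>P(\<eta> = 0) Z = 1\<close>. In \<open>[0, \<infinity>]\<close> this rules out
  \<open>Z = \<infinity>\<close>, because \<open>p \<cdot> \<infinity>\<close> is \<open>0\<close> or \<open>\<infinity>\<close>.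
\<close>

lemma finite_gibbs_law:
  assumes gibbs: "finite_gibbs_process M B \<kappa> \<Omega> \<eta>"
  shows "gibbs_weight (\<lambda>_. 1) < \<infinity>"
    and "A \<in> sets N \<Longrightarrow>
      emeasure (distr \<Omega> N \<eta>) A = 1 / gibbs_weight (\<lambda>_. 1) * gibbs_weight (indicator A)"
proof -
  let ?p = "emeasure \<Omega> (\<eta> -` level 0 \<inter> space \<Omega>)" and ?Z = "gibbs_weight (\<lambda>_. 1)"
  have \<Omega>: "prob_space \<Omega>" and \<eta> [measurable]: "\<eta> \<in> measurable \<Omega> N"
    using gibbs by (simp_all add: finite_gibbs_process_def gibbs_process_def point_process_def)
  interpret prob_space \<Omega> by fact
  have one: "?p * ?Z = 1"
    using finite_gibbs_expectation[OF gibbs, of "\<lambda>_. 1"] by (simp add: emeasure_space_1)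
  show Z: "?Z < \<infinity>"
    using one by (cases "?p = 0") (auto simp: ennreal_mult_top top.not_eq_extremum[symmetric])
  have "?p * ?Z / ?Z = ?p"
    using Z one by (intro ennreal_mult_divide_eq) auto
  then have p: "?p = 1 / ?Z"
    by (simp add: one)
  assume [measurable]: "A \<in> sets N"
  have "emeasure (distr \<Omega> N \<eta>) A = (\<integral>\<^sup>+\<omega>. indicator A (\<eta> \<omega>) \<partial>\<Omega>)"
    by (simp add: nn_integral_distr flip: nn_integral_indicator)
  also have "\<dots> = 1 / ?Z * gibbs_weight (indicator A)"
    using finite_gibbs_expectation[OF gibbs, of "indicator A"] by (simp add: p)
  finally show "emeasure (distr \<Omega> N \<eta>) A = 1 / ?Z * gibbs_weight (indicator A)" .
qed

section \<open>Existence of the Gibbs law\<close>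

lemma intensity_finite: "x \<in> space M \<Longrightarrow> \<mu> \<in> space N \<Longrightarrow> \<kappa> x \<mu> < \<infinity>"
  using intensity by (simp add: intensity_def space_N)

text \<open>
  The part of the weight carried by configurations of \<open>n\<close> points, as a measure: the image of
  \<open>\<kappa>\<^sub>n d\<lambda>\<^sup>n / n!\<close> under the map from point tuples to counting measures. Writing the weight as a sum of
  measures supplies its countable additivity.
\<close>

abbreviation weight_measure :: "nat \<Rightarrow> 'a measure measure" where
  "weight_measure n \<equiv> scale_measure (ennreal (1 / fact n))
    (distr (density (\<Pi>\<^sub>M i\<in>{1..n}. M) (\<lambda>x. kappa_m M \<kappa> n x (null_measure M))) N (dirac_sum M {1..n}))"

lemma nn_integral_weight_measure:
  assumes g [measurable]: "g \<in> borel_measurable N"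
  shows "integral\<^sup>N (weight_measure n) g = ennreal (1 / fact n) * (growth ^^ n) g (null_measure M)"
proof -
  note [measurable] = measurable_kappa_m[OF null_in_N]
  have [measurable]: "dirac_sum M {1..n} \<in> measurable (\<Pi>\<^sub>M i\<in>{1..n}. M) N"
    by (rule measurable_dirac_sum) simp_all
  show ?thesis
    by (simp add: nn_integral_scale_measure nn_integral_distr nn_integral_density growth_funpow_eq
        mult.commute del: One_nat_def)
qed

definition gibbs_law :: "'a measure measure" where
  "gibbs_law = measure_of (space N) (sets N)
    (\<lambda>A. \<Sum>n. emeasure (scale_measure (1 / gibbs_weight (\<lambda>_. 1)) (weight_measure n)) A)"

lemma sets_gibbs_law [simp, measurable_cong]: "sets gibbs_law = sets N"
  and space_gibbs_law [simp]: "space gibbs_law = space N"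
  by (simp_all add: gibbs_law_def sets.space_closed)

lemma nn_integral_gibbs_law:
  assumes g [measurable]: "g \<in> borel_measurable N"
  shows "integral\<^sup>N gibbs_law g = 1 / gibbs_weight (\<lambda>_. 1) * gibbs_weight g"
proof -
  let ?Q = "\<lambda>n. scale_measure (1 / gibbs_weight (\<lambda>_. 1)) (weight_measure n)"
  have "integral\<^sup>N gibbs_law g = (\<Sum>n. integral\<^sup>N (?Q n) g)"
  proof (rule nn_integral_suminf_measure)
    show "emeasure gibbs_law A = (\<Sum>n. emeasure (?Q n) A)" if "A \<in> sets gibbs_law" for A
      unfolding gibbs_law_def by (rule emeasure_suminf_measure) (use that in simp_all)
  qed simp_all
  also have "\<dots> = (\<Sum>n. 1 / gibbs_weight (\<lambda>_. 1) * integral\<^sup>N (weight_measure n) g)"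
    by (subst nn_integral_scale_measure) simp_all
  also have "\<dots> = 1 / gibbs_weight (\<lambda>_. 1) * gibbs_weight g"
    unfolding nn_integral_weight_measure[OF g] gibbs_weight_def by simp
  finally show ?thesis .
qed

lemma gibbs_weight_ge: "g (null_measure M) \<le> gibbs_weight g"
  unfolding gibbs_weight_def
  by (subst suminf_ennreal_split_first) simp

text \<open>A sum of \<open>n\<close> Dirac measures has mass at most \<open>n\<close>.\<close>

lemma gibbs_weight_infinite:
  "gibbs_weight (indicator {\<mu> \<in> space N. emeasure \<mu> (space M) = \<infinity>}) = 0"
proof -
  let ?A = "{\<mu> \<in> space N. emeasure \<mu> (space M) = \<infinity>}"
  have A: "?A \<in> sets N"
    by measurable
  have "indicator ?A (plus_measure (null_measure M) (dirac_sum M {1..n} x)) = (0 :: ennreal)"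
    for n :: nat and x
    by (simp add: emeasure_dirac_sum indicator_def)
  then have "(growth ^^ n) (indicator ?A) (null_measure M) = 0" for n
    using A by (simp only: growth_funpow_eq borel_measurable_indicator null_in_N) simp
  then show ?thesis
    by (simp add: gibbs_weight_def)
qed

abbreviation self_integral :: "('a \<times> 'a measure \<Rightarrow> ennreal) \<Rightarrow> 'a measure \<Rightarrow> ennreal" where
  "self_integral f \<mu> \<equiv> \<integral>\<^sup>+x. f (x, \<mu>) \<partial>\<mu>"

abbreviation growth_at :: "('a \<times> 'a measure \<Rightarrow> ennreal) \<Rightarrow> 'a \<times> 'a measure \<Rightarrow> ennreal" where
  "growth_at f \<equiv> \<lambda>(y, \<mu>). growth (\<lambda>\<nu>. f (y, \<nu>)) \<mu>"

lemma measurable_growth_at: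
  assumes [measurable]: "f \<in> borel_measurable (M \<Otimes>\<^sub>M N)"
  shows "growth_at f \<in> borel_measurable (M \<Otimes>\<^sub>M N)"
proof -
  interpret sigma_finite_measure M by (rule sigma_finite_M)
  show ?thesis
    unfolding growth_eq by measurable
qed

text \<open>
  After a point \<open>x\<close> has been added, the integral against \<open>\<mu> + \<delta>\<^sub>x\<close> consists of the integral against
  \<open>\<mu>\<close> and the value at the new point. The second part is \<open>insertion f\<close>; in the first one the
  integrals over the old and the new point are exchanged.
\<close>

lemma growth_self_integral:
  assumes f [measurable]: "f \<in> borel_measurable (M \<Otimes>\<^sub>M N)" and \<mu> [measurable]: "\<mu> \<in> space N"
  shows "growth (self_integral f) \<mu> = self_integral (growth_at f) \<mu> + insertion f \<mu>"
proof -
  note [measurable_cong] = N_sets[OF \<mu>]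
  interpret M: sigma_finite_measure M by (rule sigma_finite_M)
  interpret \<mu>: sigma_finite_measure \<mu> using \<mu> by (rule sigma_finite_N)
  interpret pair_sigma_finite M \<mu> ..
  let ?\<nu> = "\<lambda>x. plus_measure \<mu> (return M x)"
  have \<nu>: "?\<nu> x \<in> space N" for x
    using \<mu> by (simp add: plus_in_N return_in_N)
  have "growth (self_integral f) \<mu>
      = (\<integral>\<^sup>+x. (\<integral>\<^sup>+y. f (y, ?\<nu> x) * \<kappa> x \<mu> \<partial>\<mu>) + f (x, ?\<nu> x) * \<kappa> x \<mu> \<partial>M)"
    unfolding growth_eq
  proof (rule nn_integral_cong)
    fix x assume x: "x \<in> space M"
    have [measurable]: "(\<lambda>y. f (y, ?\<nu> x)) \<in> borel_measurable M"
      using \<nu>[of x] by measurable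
    have "self_integral f (?\<nu> x) = (\<integral>\<^sup>+y. f (y, ?\<nu> x) \<partial>\<mu>) + f (x, ?\<nu> x)"
      using x by (subst nn_integral_plus_measure) (simp_all add: N_sets[OF \<mu>] nn_integral_return)
    then show "self_integral f (?\<nu> x) * \<kappa> x \<mu>
        = (\<integral>\<^sup>+y. f (y, ?\<nu> x) * \<kappa> x \<mu> \<partial>\<mu>) + f (x, ?\<nu> x) * \<kappa> x \<mu>"
      by (simp add: distrib_right nn_integral_multc)
  qed
  also have "\<dots> = (\<integral>\<^sup>+x. (\<integral>\<^sup>+y. f (y, ?\<nu> x) * \<kappa> x \<mu> \<partial>\<mu>) \<partial>M) + insertion f \<mu>"
    unfolding insertion_def by (rule nn_integral_add) measurable
  also have "(\<integral>\<^sup>+x. (\<integral>\<^sup>+y. f (y, ?\<nu> x) * \<kappa> x \<mu> \<partial>\<mu>) \<partial>M) = self_integral (growth_at f) \<mu>"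
    unfolding growth_eq prod.case by (rule Fubini'[symmetric]) measurable
  finally show ?thesis .
qed

text \<open>
  Both sides add two points, one of which is marked as the argument of \<open>f\<close>: on the left the marked
  point \<open>y\<close> is added first, on the right it is added second. The cocycle relation equates the two
  densities.
\<close>

lemma insertion_growth_at:
  assumes cocycle: "cocycle M B \<kappa>"
    and f [measurable]: "f \<in> borel_measurable (M \<Otimes>\<^sub>M N)" and \<mu> [measurable]: "\<mu> \<in> space N"
  shows "insertion (growth_at f) \<mu> = growth (insertion f) \<mu>"
proof -
  interpret M: sigma_finite_measure M by (rule sigma_finite_M)
  interpret pair_sigma_finite M M ..
  let ?\<nu> = "\<lambda>x. plus_measure \<mu> (return M x)"
  let ?F = "\<lambda>y x. f (y, plus_measure (?\<nu> y) (return M x)) * \<kappa> x (?\<nu> y) * \<kappa> y \<mu>"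
  have "insertion (growth_at f) \<mu> = (\<integral>\<^sup>+y. \<integral>\<^sup>+x. ?F y x \<partial>M \<partial>M)"
    unfolding insertion_def growth_eq prod.case
    by (intro nn_integral_cong nn_integral_multc[symmetric]) measurable
  also have "\<dots> = (\<integral>\<^sup>+x. \<integral>\<^sup>+y. ?F y x \<partial>M \<partial>M)"
    by (rule Fubini') measurable
  also have "\<dots> = (\<integral>\<^sup>+x. \<integral>\<^sup>+y. f (y, plus_measure (?\<nu> x) (return M y)) * \<kappa> y (?\<nu> x) * \<kappa> x \<mu> \<partial>M \<partial>M)"
  proof (intro nn_integral_cong)
    fix x y assume "x \<in> space M" "y \<in> space M"
    then have "\<kappa> x (?\<nu> y) * \<kappa> y \<mu> = \<kappa> y (?\<nu> x) * \<kappa> x \<mu>"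
      using cocycle \<mu> by (simp add: cocycle_def space_N mult.commute)
    moreover have "plus_measure (?\<nu> y) (return M x) = plus_measure (?\<nu> x) (return M y)"
      by (rule plus_measure_right_commute) (simp_all add: N_sets[OF \<mu>])
    ultimately show "?F y x = f (y, plus_measure (?\<nu> x) (return M y)) * \<kappa> y (?\<nu> x) * \<kappa> x \<mu>"
      by (simp only: mult.assoc)
  qed
  also have "\<dots> = growth (insertion f) \<mu>"
    unfolding insertion_def growth_eq
    by (intro nn_integral_cong nn_integral_multc) measurable
  finally show ?thesis .
qed

text \<open>
  Moving \<open>self_integral\<close> to the left through one \<open>growth\<close> produces one copy of the right-hand term,
  since \<open>insertion\<close> commutes with \<open>growth\<close>. After \<open>Suc n\<close> steps there are \<open>Suc n\<close> copies, and the
  remaining term is an integral against the zero measure.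
\<close>

lemma growth_funpow_self_integral:
  assumes cocycle: "cocycle M B \<kappa>" and f: "f \<in> borel_measurable (M \<Otimes>\<^sub>M N)"
  shows "(growth ^^ Suc n) (self_integral f) (null_measure M)
    = of_nat (Suc n) * (growth ^^ n) (insertion f) (null_measure M)"
  using f
proof (induction n arbitrary: f)
  case 0
  then show ?case
    by (simp add: growth_self_integral)
next
  case (Suc n)
  note f = Suc.prems
  note f' = measurable_growth_at[OF f]
  let ?c = "(growth ^^ Suc n) (insertion f) (null_measure M)"
  have "(growth ^^ Suc (Suc n)) (self_integral f) (null_measure M)
      = (growth ^^ Suc n) (growth (self_integral f)) (null_measure M)"
    by (simp only: funpow_Suc_right comp_def)
  also have "\<dots> = (growth ^^ Suc n) (\<lambda>\<mu>. self_integral (growth_at f) \<mu> + insertion f \<mu>) (null_measure M)"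
    by (rule growth_funpow_cong) (simp_all only: growth_self_integral[OF f] null_in_N)
  also have "\<dots> = (growth ^^ Suc n) (self_integral (growth_at f)) (null_measure M) + ?c"
    by (rule growth_funpow_add[OF measurable_integral_self[OF f'] measurable_insertion[OF f] null_in_N])
  also have "(growth ^^ Suc n) (self_integral (growth_at f)) (null_measure M)
      = of_nat (Suc n) * (growth ^^ n) (insertion (growth_at f)) (null_measure M)"
    by (rule Suc.IH[OF f'])
  also have "(growth ^^ n) (insertion (growth_at f)) (null_measure M)
      = (growth ^^ n) (growth (insertion f)) (null_measure M)"
    by (rule growth_funpow_cong) (simp_all only: insertion_growth_at[OF cocycle f] null_in_N)
  also have "(growth ^^ n) (growth (insertion f)) (null_measure M) = ?c"
    by (simp only: funpow_Suc_right comp_def)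
  also have "of_nat (Suc n) * ?c + ?c = of_nat (Suc (Suc n)) * ?c"
    by (simp only: of_nat_Suc distrib_right mult_1_left add.commute)
  finally show ?case .
qed

lemma gibbs_weight_self_integral:
  assumes cocycle: "cocycle M B \<kappa>" and f: "f \<in> borel_measurable (M \<Otimes>\<^sub>M N)"
  shows "gibbs_weight (self_integral f) = gibbs_weight (insertion f)"
proof -
  have "gibbs_weight (self_integral f)
      = (\<Sum>n. ennreal (1 / fact (Suc n)) * (growth ^^ Suc n) (self_integral f) (null_measure M))"
    unfolding gibbs_weight_def by (subst suminf_ennreal_split_first) simp
  also have "\<dots> = gibbs_weight (insertion f)"
    unfolding gibbs_weight_def
  proof (rule suminf_cong)
    fix n
    have "ennreal (1 / fact (Suc n)) * of_nat (Suc n) = ennreal (1 / fact (Suc n) * real (Suc n))"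
      by (simp only: ennreal_of_nat_eq_real_of_nat) (rule ennreal_mult[symmetric], simp_all)
    also have "1 / fact (Suc n) * real (Suc n) = 1 / fact n"
      by (simp del: of_nat_Suc)
    finally have "ennreal (1 / fact (Suc n)) * of_nat (Suc n) = ennreal (1 / fact n)" .
    then show "ennreal (1 / fact (Suc n)) * (growth ^^ Suc n) (self_integral f) (null_measure M)
        = ennreal (1 / fact n) * (growth ^^ n) (insertion f) (null_measure M)"
      unfolding growth_funpow_self_integral[OF cocycle f] mult.assoc[symmetric] by (simp only:)
  qed
  finally show ?thesis .
qed

lemma finite_gibbs_process_gibbs_law:
  assumes cocycle: "cocycle M B \<kappa>" and Z: "gibbs_weight (\<lambda>_. 1) < \<infinity>"
  shows "finite_gibbs_process M B \<kappa> gibbs_law (\<lambda>\<mu>. \<mu>)"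
  unfolding finite_gibbs_process_def gibbs_process_def point_process_def
proof (intro conjI ballI)
  show "intensity M B \<kappa>"
    by (rule intensity)
  have "gibbs_weight (\<lambda>_. 1) \<noteq> 0"
    using gibbs_weight_ge[of "\<lambda>_. 1"] by auto
  then have "1 / gibbs_weight (\<lambda>_. 1) * gibbs_weight (\<lambda>_. 1) = 1"
    using Z ennreal_divide_times[of 1 "gibbs_weight (\<lambda>_. 1)" "gibbs_weight (\<lambda>_. 1)"] by (simp add: less_top)
  then have "integral\<^sup>N gibbs_law (\<lambda>_. 1) = 1"
    by (simp only: nn_integral_gibbs_law measurable_const UNIV_I space_borel)
  then show "prob_space gibbs_law"
    by (intro prob_spaceI) simp
  show "(\<lambda>\<mu>. \<mu>) \<in> measurable gibbs_law N"
    by (simp add: measurable_ident_sets)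
  show "(\<integral>\<^sup>+\<mu>. self_integral f \<mu> \<partial>gibbs_law)
      = (\<integral>\<^sup>+\<mu>. (\<integral>\<^sup>+x. f (x, plus_measure \<mu> (return M x)) * \<kappa> x \<mu> \<partial>M) \<partial>gibbs_law)"
    if f: "f \<in> borel_measurable (M \<Otimes>\<^sub>M N)" for f
    unfolding insertion_def[symmetric]
    by (simp only: nn_integral_gibbs_law measurable_integral_self[OF f] measurable_insertion[OF f]
        gibbs_weight_self_integral[OF cocycle f])
  have A: "{\<mu> \<in> space N. emeasure \<mu> (space M) = \<infinity>} \<in> sets N"
    by measurable
  have "emeasure gibbs_law {\<mu> \<in> space N. emeasure \<mu> (space M) = \<infinity>}
      = (\<integral>\<^sup>+\<mu>. indicator {\<mu> \<in> space N. emeasure \<mu> (space M) = \<infinity>} \<mu> \<partial>gibbs_law)"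
    using A by simp
  also have "\<dots> = 0"
    using A by (simp only: nn_integral_gibbs_law borel_measurable_indicator gibbs_weight_infinite) simp
  finally have "AE \<mu> in gibbs_law. \<not> emeasure \<mu> (space M) = \<infinity>"
    using A by (intro AE_I[of _ _ "{\<mu> \<in> space N. emeasure \<mu> (space M) = \<infinity>}"]) auto
  then show "AE \<mu> in gibbs_law. finite_measure \<mu>"
    by (rule AE_mp) (auto intro!: AE_I2 finite_measureI simp: N_space)
qed

end

section \<open>The intensity with boundary condition\<close>

context intensity_space
begin

context
  fixes C :: "'a set" and \<psi> :: "'a measure"
  assumes C [measurable]: "C \<in> sets M" and \<psi>: "\<psi> \<in> space N"
begin

lemma intensity_restricted: "intensity M B (restricted_intensity \<kappa> C \<psi>)"
  unfolding intensity_def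
proof (intro conjI ballI)
  note [measurable] = \<psi>
  have "(\<lambda>z. \<kappa> (fst z) (plus_measure \<psi> (snd z)) * indicator C (fst z))
      \<in> borel_measurable (M \<Otimes>\<^sub>M N)"
    by measurable
  then show "(\<lambda>(x, \<mu>). restricted_intensity \<kappa> C \<psi> x \<mu>) \<in> borel_measurable (M \<Otimes>\<^sub>M N)"
    by (simp add: restricted_intensity_def case_prod_beta')
  show "restricted_intensity \<kappa> C \<psi> x \<mu> < \<infinity>"
    if "x \<in> space M" "\<mu> \<in> counting_measures M B" for x \<mu>
    using intensity_finite[OF that(1) plus_in_N[OF \<psi>]] that(2)
    by (simp add: restricted_intensity_def space_N split: split_indicator)
qed

lemma cocycle_restricted:
  assumes "cocycle M B \<kappa>"
  shows "cocycle M B (restricted_intensity \<kappa> C \<psi>)"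
  unfolding cocycle_def
proof (intro ballI)
  fix x y \<mu> assume xy: "x \<in> space M" "y \<in> space M" and "\<mu> \<in> counting_measures M B"
  then have \<mu>: "\<mu> \<in> space N"
    by (simp add: space_N)
  have "plus_measure \<psi> \<mu> \<in> counting_measures M B"
    using plus_in_N[OF \<psi> \<mu>] by (simp add: space_N)
  then have "\<kappa> x (plus_measure \<psi> \<mu>) * \<kappa> y (plus_measure \<psi> (plus_measure \<mu> (return M x)))
      = \<kappa> y (plus_measure \<psi> \<mu>) * \<kappa> x (plus_measure \<psi> (plus_measure \<mu> (return M y)))"
    using assms xy
    by (simp add: cocycle_def N_sets[OF \<psi>] N_sets[OF \<mu>] flip: plus_measure_assoc)
  then show "restricted_intensity \<kappa> C \<psi> x \<mu> * restricted_intensity \<kappa> C \<psi> y (plus_measure \<mu> (return M x))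
      = restricted_intensity \<kappa> C \<psi> y \<mu> * restricted_intensity \<kappa> C \<psi> x (plus_measure \<mu> (return M y))"
    by (simp add: restricted_intensity_def split: split_indicator)
qed

text \<open>
  The factors \<open>indicator C (x i)\<close> multiply to the indicator of \<open>C\<^sup>n\<close>. The boundary configuration \<open>\<psi>\<close>
  becomes the starting point of \<open>kappa_m\<close>, so the results for a process that grows from the zero
  measure apply to the restricted intensity.
\<close>

lemma kappa_m_restricted:
  assumes "x \<in> space (\<Pi>\<^sub>M i\<in>{1..n}. M)"
  shows "kappa_m M (restricted_intensity \<kappa> C \<psi>) n x (null_measure M)
    = kappa_m M \<kappa> n x \<psi> * indicator (\<Pi>\<^sub>E i\<in>{1..n}. C) x"
proof -
  have "kappa_m M (restricted_intensity \<kappa> C \<psi>) n x (null_measure M)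
      = kappa_m M \<kappa> n x \<psi> * (\<Prod>i=1..n. indicator C (x i))"
    by (simp add: kappa_m_def restricted_intensity_def prod.distrib)
  also have "(\<Prod>i=1..n. indicator C (x i)) = (indicator (\<Pi>\<^sub>E i\<in>{1..n}. C) x :: ennreal)"
    using assms by (auto simp: indicator_def space_PiM PiE_iff prod_zero_iff)
  finally show ?thesis .
qed

interpretation restricted: intensity_space M B "restricted_intensity \<kappa> C \<psi>"
  by unfold_locales (rule intensity_restricted)

lemma gibbs_weight_restricted:
  assumes g: "g \<in> borel_measurable N"
  shows "restricted.gibbs_weight g = g (null_measure M) + (\<Sum>n. ennreal (1 / fact (Suc n)) *
    (\<integral>\<^sup>+ x \<in> (\<Pi>\<^sub>E i\<in>{1..Suc n}. C). g (dirac_sum M {1..Suc n} x) * kappa_m M \<kappa> (Suc n) x \<psi>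
      \<partial>(\<Pi>\<^sub>M i\<in>{1..Suc n}. M)))"
proof -
  have "(restricted.growth ^^ n) g (null_measure M)
      = (\<integral>\<^sup>+ x \<in> (\<Pi>\<^sub>E i\<in>{1..n}. C). g (dirac_sum M {1..n} x) * kappa_m M \<kappa> n x \<psi>
          \<partial>(\<Pi>\<^sub>M i\<in>{1..n}. M))" for n
    unfolding restricted.growth_funpow_eq[OF g null_in_N]
    by (intro nn_integral_cong) (simp add: kappa_m_restricted mult.assoc del: One_nat_def)
  then show ?thesis
    unfolding restricted.gibbs_weight_def
    by (subst suminf_ennreal_split_first) (simp del: One_nat_def fact_Suc funpow.simps(2))
qed

lemma partition_function_eq: "partition_function M \<kappa> C \<psi> = restricted.gibbs_weight (\<lambda>_. 1)"
  by (subst gibbs_weight_restricted)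
     (simp_all only: partition_function_def mult_1_left measurable_const UNIV_I space_borel)

lemma finite_gibbs_process_restricted_iff:
  assumes "cocycle M B \<kappa>"
  shows "(\<exists>(\<Omega> :: 'a measure measure) \<xi>.
      finite_gibbs_process M B (restricted_intensity \<kappa> C \<psi>) \<Omega> \<xi>)
    \<longleftrightarrow> partition_function M \<kappa> C \<psi> < \<infinity>"
  unfolding partition_function_eq
  using restricted.finite_gibbs_process_gibbs_law[OF cocycle_restricted[OF assms]]
    restricted.finite_gibbs_law(1)
  by blast

lemma finite_gibbs_process_restricted_law:
  assumes "finite_gibbs_process M B (restricted_intensity \<kappa> C \<psi>) \<Omega> \<xi>"
  shows "partition_function M \<kappa> C \<psi> < \<infinity>"
    and "A \<in> sets N \<Longrightarrow> emeasure (distr \<Omega> N \<xi>) A =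
      1 / partition_function M \<kappa> C \<psi> *
      (indicator A (null_measure M) +
       (\<Sum>n. ennreal (1 / fact (Suc n)) *
         (\<integral>\<^sup>+ x \<in> (\<Pi>\<^sub>E i\<in>{1..Suc n}. C).
            indicator A (dirac_sum M {1..Suc n} x) * kappa_m M \<kappa> (Suc n) x \<psi>
          \<partial>(\<Pi>\<^sub>M i\<in>{1..Suc n}. M))))"
  unfolding partition_function_eq gibbs_weight_restricted[OF borel_measurable_indicator, symmetric]
  using restricted.finite_gibbs_law[OF assms] by auto

end

end

theorem lemma4p4:
  fixes lambda :: "'a measure" and B :: "nat \<Rightarrow> 'a set"
    and \<kappa> :: "'a \<Rightarrow> 'a measure \<Rightarrow> ennreal"
    and C :: "'a set" and \<psi> :: "'a measure"
  assumes "localizing lambda B"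
    and "locally_finite lambda B"
    and "intensity lambda B \<kappa>"
    and "cocycle lambda B \<kappa>"
    and "C \<in> sets lambda"
    and "\<psi> \<in> counting_measures lambda B"
  shows "((\<exists>(\<Omega> :: 'a measure measure) \<xi>.
            finite_gibbs_process lambda B (restricted_intensity \<kappa> C \<psi>) \<Omega> \<xi>)
          \<longleftrightarrow> partition_function lambda \<kappa> C \<psi> < \<infinity>) \<and>
    (\<forall>(\<Omega> :: 'w measure) \<xi>.
      finite_gibbs_process lambda B (restricted_intensity \<kappa> C \<psi>) \<Omega> \<xi> \<longrightarrow>
        partition_function lambda \<kappa> C \<psi> < \<infinity> \<and>
        (\<forall>A \<in> sets (counting_algebra lambda B).
          emeasure (distr \<Omega> (counting_algebra lambda B) \<xi>) A =
            1 / partition_function lambda \<kappa> C \<psi> *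
            (indicator A (null_measure lambda) +
             (\<Sum>n. ennreal (1 / fact (Suc n)) *
               (\<integral>\<^sup>+ x \<in> (\<Pi>\<^sub>E i\<in>{1..Suc n}. C).
                  indicator A (dirac_sum lambda {1..Suc n} x) * kappa_m lambda \<kappa> (Suc n) x \<psi>
                \<partial>(\<Pi>\<^sub>M i\<in>{1..Suc n}. lambda))))))"
proof -
  interpret intensity_space lambda B \<kappa>
    using assms by unfold_locales
  have \<psi>: "\<psi> \<in> space (counting_algebra lambda B)"
    using assms by (simp only: space_N)
  show ?thesis
    using finite_gibbs_process_restricted_iff[OF assms(5) \<psi> assms(4)]
      finite_gibbs_process_restricted_law[OF assms(5) \<psi>]
    by blast
qed

end
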